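(* For every $d\in\mathbb N$ there is a constant $C=C(d)>0$ such that, for every pair of distinct real numbers $x,y\ge C$, $\mathcal A_d(1,x)\not\subseteq\mathcal A_d(1,y)$.
   Context: Let $\mathbb N=\{1,2,\dots\}$. For real numbers $R_2\ge R_1\ge 0$ and $d\in\mathbb N$, $\mathcal A_d(R_1,R_2)$ denotes the family of finite simple graphs $G$ that admit an $(R_1,R_2)$-annulus embedding in $\mathbb R^d$, that is, an injective map from $V(G)$ to $\mathbb R^d$ such that for all pairs of different vertices $u,v$, $uv$ is an edge of $G$ if and only if the Euclidean distance between the images of $u$ and $v$ is in $[R_1,R_2]$. *)

theory Defs
  imports "HOL-Analysis.Analysis"
begin

text \<open>A graph is a pair of a vertex set and a set of edges, each edge being the set of its
  two end vertices.\<close>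

type_synonym 'v ugraph = "'v set \<times> 'v set set"

abbreviation vertices :: "'v ugraph \<Rightarrow> 'v set" where
  "vertices G \<equiv> fst G"

abbreviation edges :: "'v ugraph \<Rightarrow> 'v set set" where
  "edges G \<equiv> snd G"

definition finite_simple_graph :: "'v ugraph \<Rightarrow> bool" where
  "finite_simple_graph G \<longleftrightarrow>
     finite (vertices G) \<and> (\<forall>e\<in>edges G. e \<subseteq> vertices G \<and> card e = 2)"

definition annulus_embedding ::
    "real \<Rightarrow> real \<Rightarrow> 'v ugraph \<Rightarrow> ('v \<Rightarrow> real ^ 'd) \<Rightarrow> bool" where
  "annulus_embedding R1 R2 G f \<longleftrightarrow>
     inj_on f (vertices G) \<and>
     (\<forall>u\<in>vertices G. \<forall>v\<in>vertices G. u \<noteq> v \<longrightarrow>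
        ({u, v} \<in> edges G \<longleftrightarrow> dist (f u) (f v) \<in> {R1..R2}))"

text \<open>The dimension is the cardinality of the index type \<open>'d\<close>, passed as \<open>TYPE('d)\<close>. Finite
  graphs are considered up to isomorphism, so natural numbers serve as vertices; a polymorphic
  vertex type could be instantiated by a finite one, which would bound the order of the graphs.
  The definition is meant for \<open>0 \<le> R1 \<le> R2\<close>.\<close>

definition annulus_graphs :: "'d::finite itself \<Rightarrow> real \<Rightarrow> real \<Rightarrow> nat ugraph set" where
  "annulus_graphs _ R1 R2 =
     {G. finite_simple_graph G \<and> (\<exists>f :: nat \<Rightarrow> real ^ 'd. annulus_embedding R1 R2 G f)}"

end

theory Submission
  imports Defs
begin

text \<open>
  If the inclusion holds, every finite set of points admits a map that turns adjacency for the
  annulus \<open>[1, x]\<close> into adjacency for \<open>[1, y]\<close>. Such maps distinguish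
  distances below \<open>1\<close> from distances above the outer radius: the number of unit vectors
  with pairwise angles above 60 degrees that fit in a whole sphere exceeds the number that fit in the
  common neighbourhood of two points at distance more than \<open>y\<close>. So distances below
  \<open>1\<close> stay below \<open>1\<close>, which makes the maps coarsely Lipschitz, and distances
  above \<open>x\<close> go to distances above \<open>y\<close>. If \<open>y < x\<close>, edges contract by
  the factor \<open>y / x\<close> on a large scale while 1-separated sets stay 1-separated; if
  \<open>x < y\<close>, sets with separation slightly above \<open>x\<close> become
  \<open>y\<close>-separated although the maps are 1-Lipschitz on a large scale. Either way,
  iterated shrinking packs arbitrarily many 1-separated points into a fixed ball.
\<close>

section \<open>Separated sets in balls\<close>

abbreviation separated :: "'a::metric_space set \<Rightarrow> bool" where
  "separated S \<equiv> pairwise (\<lambda>p q. 1 \<le> dist p q) S"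

lemma separated_image:
  assumes "\<And>i j. i \<in> I \<Longrightarrow> j \<in> I \<Longrightarrow> i \<noteq> j \<Longrightarrow> 1 \<le> dist (g i) (g j)"
  shows "separated (g ` I)" "card (g ` I) = card I"
proof -
  show "separated (g ` I)"
  proof (rule pairwiseI)
    fix a b assume "a \<in> g ` I" "b \<in> g ` I" "a \<noteq> b"
    then show "1 \<le> dist a b" using assms by blast
  qed
  have "inj_on g I"
  proof (rule inj_onI, rule ccontr)
    fix i j assume "i \<in> I" "j \<in> I" "g i = g j" "i \<noteq> j"
    then show False using assms[of i j] by simp
  qed
  then show "card (g ` I) = card I" by (rule card_image)
qed

text \<open>Total boundedness covers the ball by finitely many balls of radius \<open>1/2\<close>,
  each holding at most one point of \<open>S\<close>. Covering a ball about \<open>0\<close> and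
  translating makes \<open>k\<close> independent of the centre.\<close>

lemma separated_card_bounded:
  fixes R :: real
  obtains k :: nat where
    "\<And>(a::'a::euclidean_space) S. S \<subseteq> cball a R \<Longrightarrow> separated S \<Longrightarrow> finite S \<and> card S \<le> k"
proof -
  obtain K where K: "finite K" "cball (0::'a) R \<subseteq> (\<Union>c\<in>K. ball c (1/2))"
    using compact_cball[of "0::'a" R, unfolded compact_eq_totally_bounded]
    by (meson zero_less_divide_1_iff zero_less_numeral)
  have "finite S \<and> card S \<le> card K" if S: "S \<subseteq> cball a R" and sep: "separated S"
    for a :: 'a and S
  proof -
    have "\<exists>c\<in>K. dist c (s - a) < 1/2" if "s \<in> S" for s
    proof -
      have "s - a \<in> cball 0 R"
        using S that by (auto simp: dist_norm norm_minus_commute)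
      then show ?thesis using K(2) by (meson UN_E mem_ball subsetD)
    qed
    then obtain c where c: "\<And>s. s \<in> S \<Longrightarrow> c s \<in> K" "\<And>s. s \<in> S \<Longrightarrow> dist (c s) (s - a) < 1/2"
      by metis
    have "inj_on c S"
    proof (rule inj_onI, rule ccontr)
      fix s t assume st: "s \<in> S" "t \<in> S" "c s = c t" "s \<noteq> t"
      then have "dist (s - a) (t - a) < 1"
        using c(2)[of s] c(2)[of t] dist_triangle3[of "s - a" "t - a" "c s"] by auto
      moreover have "dist s t \<ge> 1" using sep st by (auto simp: pairwise_def)
      ultimately show False by (simp add: dist_norm)
    qed
    moreover have "c ` S \<subseteq> K" using c(1) by auto
    ultimately show ?thesis using K(1) card_inj_on_le inj_on_finite by metis
  qed
  then show ?thesis using that by blast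
qed

text \<open>Used later to pick one point per ray. If every \<open>z\<close> failed, some
  \<open>u\<close> nonadjacent to all of \<open>Z\<close> would lie within \<open>1\<close> of
  \<open>z\<close>. A point \<open>w\<close> of \<open>Z\<close> with
  \<open>dist z w < y / 3\<close> then has \<open>dist u w < 1 + y / 3\<close>, below
  \<open>y\<close>, hence also below \<open>1\<close>. So the cluster of \<open>z\<close> fits into
  a unit ball, and too few clusters cover \<open>Z\<close>.\<close>

lemma separated_far_point:
  obtains N :: nat where
    "\<And>(y::real) (a::'a::euclidean_space) Z.
       3 \<le> y \<Longrightarrow> Z \<subseteq> cball a y \<Longrightarrow> separated Z \<Longrightarrow> N \<le> card Z \<Longrightarrow>
       \<exists>z\<in>Z. \<forall>u. (\<forall>w\<in>Z. dist u w < 1 \<or> y < dist u w) \<longrightarrow> y < dist u z"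
proof -
  obtain k where k: "\<And>(a::'a) S. S \<subseteq> cball a 1 \<Longrightarrow> separated S \<Longrightarrow> finite S \<and> card S \<le> k"
    using separated_card_bounded by blast
  obtain K where K: "finite K" "cball (0::'a) 1 \<subseteq> (\<Union>c\<in>K. ball c (1/6))"
    using compact_cball[of "0::'a" 1, unfolded compact_eq_totally_bounded]
    by (meson zero_less_divide_1_iff zero_less_numeral)
  have "\<exists>z\<in>Z. \<forall>u. (\<forall>w\<in>Z. dist u w < 1 \<or> y < dist u w) \<longrightarrow> y < dist u z"
    if y: "3 \<le> y" and Z: "Z \<subseteq> cball a y" "separated Z" and card: "card K * k + 1 \<le> card Z"
    for y a and Z :: "'a set"
  proof (rule ccontr)
    assume "\<not> ?thesis"
    then have bad: "\<exists>u. (\<forall>w\<in>Z. dist u w < 1 \<or> y < dist u w) \<and> dist u z \<le> y" if "z \<in> Z" for z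
      using that by force
    \<comment> \<open>Clusters of diameter below \<open>y / 3\<close>. Rescaling by \<open>y\<close>
      keeps their number at \<open>card K\<close>, so \<open>N\<close> does not depend on
      \<open>y\<close>.\<close>
    define A where "A c = {z \<in> Z. dist c ((z - a) /\<^sub>R y) < 1/6}" for c
    have close: "dist z w < y / 3" if "z \<in> A c" "w \<in> A c" for c z w
    proof -
      have "dist ((z - a) /\<^sub>R y) ((w - a) /\<^sub>R y) < 1/3"
        using that dist_triangle3[of "(z - a) /\<^sub>R y" "(w - a) /\<^sub>R y" c] by (auto simp: A_def)
      moreover have "(z - a) /\<^sub>R y - (w - a) /\<^sub>R y = (z - w) /\<^sub>R y"
        by (simp add: algebra_simps)
      moreover have "norm ((z - w) /\<^sub>R y) = norm (z - w) / y"
        using y by (simp add: divide_inverse mult.commute)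
      ultimately have "norm (z - w) / y < 1/3"
        unfolding dist_norm by metis
      then show ?thesis using y by (simp add: dist_norm field_simps)
    qed
    have Ak: "card (A c) \<le> k" for c
    proof (cases "A c = {}")
      case False
      then obtain z where z: "z \<in> A c" by auto
      then obtain u where u: "\<forall>w\<in>Z. dist u w < 1 \<or> y < dist u w" "dist u z \<le> y"
        using bad unfolding A_def by blast
      have "dist u z < 1" using u z unfolding A_def by force
      have "A c \<subseteq> cball u 1"
      proof
        fix w assume w: "w \<in> A c"
        have "dist u w \<le> dist u z + dist z w" by (rule dist_triangle)
        also have "\<dots> < y" using close[OF z w] \<open>dist u z < 1\<close> y by linarith
        finally show "w \<in> cball u 1" using u(1) w unfolding A_def by force
      qed
      moreover have "separated (A c)" using Z(2) by (auto simp: A_def pairwise_def)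
      ultimately show ?thesis using k by blast
    qed simp
    have "Z \<subseteq> (\<Union>c\<in>K. A c)"
    proof
      fix z assume "z \<in> Z"
      then have "norm (z - a) \<le> y" using Z(1) by (auto simp: dist_norm norm_minus_commute)
      then have "(z - a) /\<^sub>R y \<in> cball 0 1" using y by (simp add: divide_simps)
      then obtain c where "c \<in> K" "dist c ((z - a) /\<^sub>R y) < 1/6"
        using K(2) by (meson UN_E mem_ball subsetD)
      then show "z \<in> (\<Union>c\<in>K. A c)" using \<open>z \<in> Z\<close> by (auto simp: A_def)
    qed
    \<comment> \<open>An infinite set has \<open>card\<close> equal to \<open>0\<close>, which the
      lower bound on \<open>card Z\<close> excludes.\<close>
    moreover have "finite Z" using card card.infinite by fastforce
    ultimately have "card Z \<le> card (\<Union>c\<in>K. A c)"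
      using K(1) by (intro card_mono) (auto simp: A_def)
    also have "\<dots> \<le> (\<Sum>c\<in>K. card (A c))" using K(1) by (rule card_UN_le)
    also have "\<dots> \<le> card K * k" using sum_mono[of K "\<lambda>c. card (A c)" "\<lambda>_. k"] Ak by simp
    finally show False using card by simp
  qed
  then show ?thesis using that by blast
qed

section \<open>Directions at pairwise angles above 60 degrees\<close>

text \<open>For unit vectors, inner product below \<open>1/2\<close> means distance above
  \<open>1\<close>. Strictness leaves a positive margin in every finite family.\<close>

definition wide_directions :: "'a::euclidean_space set \<Rightarrow> bool" where
  "wide_directions V \<longleftrightarrow> V \<subseteq> sphere 0 1 \<and> pairwise (\<lambda>v w. v \<bullet> w < 1/2) V"

lemma norm_diff_unit:
  fixes v w :: "'a::euclidean_space"
  assumes "norm v = 1" "norm w = 1"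
  shows "(norm (v - w))\<^sup>2 = 2 - 2 * (v \<bullet> w)"
proof -
  have "v \<bullet> v = 1" "w \<bullet> w = 1" using assms by (simp_all add: norm_eq_1)
  then show ?thesis
    by (simp add: power2_norm_eq_inner inner_diff_left inner_diff_right inner_commute[of w v])
qed

text \<open>Finitely many distances above \<open>1\<close> have a minimum above \<open>1\<close>.
  The margin makes points far out on different rays nonadjacent.\<close>

lemma wide_directions_gap:
  assumes V: "wide_directions V" and "finite V"
  obtains \<delta> :: real where "\<delta> > 0" "\<And>v w. v \<in> V \<Longrightarrow> w \<in> V \<Longrightarrow> v \<noteq> w \<Longrightarrow> 1 + \<delta> \<le> norm (v - w)"
proof -
  \<comment> \<open>The extra element \<open>2\<close> keeps \<open>D\<close> nonempty when
    \<open>V\<close> has fewer than two elements.\<close>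
  define D where "D = insert 2 ((\<lambda>(v,w). norm (v - w)) ` (V \<times> V - Id))"
  have fin: "finite D" using assms(2) unfolding D_def by simp
  have "1 < d" if "d \<in> D" for d
  proof -
    have "1 < norm (v - w)" if "v \<in> V" "w \<in> V" "v \<noteq> w" for v w
    proof -
      have "v \<bullet> w < 1/2" "norm v = 1" "norm w = 1"
        using V that by (auto simp: wide_directions_def pairwise_def)
      then have "1\<^sup>2 < (norm (v - w))\<^sup>2" by (simp add: norm_diff_unit)
      then show ?thesis by (rule power_less_imp_less_base) simp
    qed
    then show ?thesis using that unfolding D_def by auto
  qed
  then have "Min D - 1 > 0" using fin Min_in[of D] by (simp add: D_def)
  moreover have "1 + (Min D - 1) \<le> norm (v - w)" if "v \<in> V" "w \<in> V" "v \<noteq> w" for v w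
  proof -
    have "norm (v - w) \<in> D" using that unfolding D_def by force
    then show ?thesis using fin by simp
  qed
  ultimately show ?thesis using that by blast
qed

text \<open>Such sets are separated subsets of the unit ball, so their sizes are bounded and a
  largest one exists. The intended contradiction is a set with one more direction.\<close>

lemma wide_directions_maximal:
  obtains V :: "'a::euclidean_space set" where "wide_directions V" "finite V"
    "\<And>W::'a set. wide_directions W \<Longrightarrow> card W \<le> card V"
proof -
  obtain k where k: "\<And>(a::'a) S. S \<subseteq> cball a 1 \<Longrightarrow> separated S \<Longrightarrow> finite S \<and> card S \<le> k"
    using separated_card_bounded by blast
  have *: "finite W \<and> card W \<le> k" if W: "wide_directions W" for W :: "'a set"
  proof (rule k[of W 0])
    show "W \<subseteq> cball 0 1" using W by (auto simp: wide_directions_def)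
    show "separated W"
    proof (rule pairwiseI)
      fix v w assume "v \<in> W" "w \<in> W" "v \<noteq> w"
      then have "v \<bullet> w < 1/2" "norm v = 1" "norm w = 1"
        using W by (auto simp: wide_directions_def pairwise_def)
      then have "1\<^sup>2 \<le> (norm (v - w))\<^sup>2" by (simp add: norm_diff_unit)
      then show "1 \<le> dist v w" unfolding dist_norm by (rule power2_le_imp_le) simp
    qed
  qed
  have "wide_directions ({}::'a set)" by (simp add: wide_directions_def)
  moreover have "\<forall>W::'a set. wide_directions W \<longrightarrow> card W < k + 1"
    using * by (simp add: le_imp_less_Suc)
  ultimately have "\<exists>V::'a set. wide_directions V \<and> (\<forall>W::'a set. wide_directions W \<longrightarrow> card W \<le> card V)"
    using Lattices_Big.ex_has_greatest_nat[of wide_directions "{} :: 'a set" card "k + 1"] by simp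
  then show ?thesis using that * by metis
qed

text \<open>In the triangle \<open>0\<close>, \<open>a\<close>, \<open>b\<close> the side from
  \<open>a\<close> to \<open>b\<close> is strictly the longest, so the opposite angle exceeds 60
  degrees.\<close>

lemma inner_sgn_far:
  fixes a b :: "'a::euclidean_space"
  assumes "a \<noteq> 0" "b \<noteq> 0" "norm a \<le> y" "norm b \<le> y" "y < norm (a - b)"
  shows "sgn a \<bullet> sgn b < 1/2"
proof -
  have y: "0 \<le> y" using assms(3) norm_ge_zero order_trans by blast
  then have "y\<^sup>2 < (norm (a - b))\<^sup>2" using assms(5) by (simp add: power_strict_mono)
  also have "\<dots> = (norm a)\<^sup>2 + (norm b)\<^sup>2 - 2 * (a \<bullet> b)"
    by (simp add: power2_norm_eq_inner inner_diff_left inner_diff_right inner_commute[of b a])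
  finally have *: "y\<^sup>2 < (norm a)\<^sup>2 + (norm b)\<^sup>2 - 2 * (a \<bullet> b)" .
  have "(norm a)\<^sup>2 \<le> y\<^sup>2" "(norm b)\<^sup>2 \<le> y\<^sup>2" using assms by (auto intro!: power_mono)
  with * have "2 * (a \<bullet> b) < (norm b)\<^sup>2" "2 * (a \<bullet> b) < (norm a)\<^sup>2" by linarith+
  moreover have "(norm b)\<^sup>2 \<le> norm a * norm b \<or> (norm a)\<^sup>2 \<le> norm a * norm b"
    by (cases "norm a \<le> norm b") (auto simp: power2_eq_square intro: mult_mono)
  ultimately have "2 * (a \<bullet> b) < norm a * norm b" by linarith
  then show ?thesis using assms(1,2) by (simp add: sgn_div_norm field_simps)
qed

text \<open>Seen from \<open>p\<close>, the lens lies in an open half-space towards \<open>q\<close>, so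
  the direction opposite to \<open>q\<close> can be added.\<close>

lemma wide_directions_lens:
  fixes z :: "'a::euclidean_space \<Rightarrow> 'a"
  assumes "y < dist p q" and fin: "finite V"
    and z: "\<And>v. v \<in> V \<Longrightarrow> z v \<noteq> p" "\<And>v. v \<in> V \<Longrightarrow> dist p (z v) \<le> y"
      "\<And>v. v \<in> V \<Longrightarrow> dist q (z v) \<le> y"
    and far: "\<And>v w. v \<in> V \<Longrightarrow> w \<in> V \<Longrightarrow> v \<noteq> w \<Longrightarrow> y < dist (z v) (z w)"
    and "0 \<le> y"
  obtains W :: "'a set" where "wide_directions W" "card W = card V + 1"
proof -
  define s where "s v = sgn (z v - p)" for v
  define e where "e = - sgn (q - p)"
  have "q \<noteq> p" using assms(1) \<open>0 \<le> y\<close> by auto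
  have norm_s: "norm (s v) = 1" if "v \<in> V" for v
    using z(1)[OF that] by (simp add: s_def norm_sgn)
  have norm_e: "norm e = 1" using \<open>q \<noteq> p\<close> by (simp add: e_def norm_sgn)
  have ss: "s v \<bullet> s w < 1/2" if "v \<in> V" "w \<in> V" "v \<noteq> w" for v w
    unfolding s_def
  proof (rule inner_sgn_far[where y=y])
    show "y < norm (z v - p - (z w - p))" using far[OF that] by (simp add: dist_norm)
  qed (use z that in \<open>auto simp: dist_norm norm_minus_commute\<close>)
  \<comment> \<open>\<open>z v\<close> is strictly nearer to \<open>q\<close> than \<open>p\<close>
    is; expanding the squares gives a positive inner product with \<open>q - p\<close>.\<close>
  have se: "s v \<bullet> e < 0" if "v \<in> V" for v
  proof -
    have "norm ((z v - p) - (q - p)) < norm (q - p)"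
      using z(3)[OF that] assms(1) by (simp add: dist_norm norm_minus_commute)
    then have "(norm ((z v - p) - (q - p)))\<^sup>2 < (norm (q - p))\<^sup>2"
      by (simp add: power_strict_mono)
    moreover have "(norm ((z v - p) - (q - p)))\<^sup>2
        = (norm (z v - p))\<^sup>2 + (norm (q - p))\<^sup>2 - 2 * ((z v - p) \<bullet> (q - p))"
      unfolding power2_norm_eq_inner inner_diff_left[of "z v - p" "q - p"]
        inner_diff_right[of _ "z v - p" "q - p"] inner_commute[of "q - p" "z v - p"] by simp
    moreover have "0 \<le> (norm (z v - p))\<^sup>2" by simp
    ultimately have "0 < (z v - p) \<bullet> (q - p)" by linarith
    then show ?thesis using z(1)[OF that] \<open>q \<noteq> p\<close>
      by (simp add: s_def e_def sgn_div_norm)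
  qed
  have inj: "inj_on s V"
  proof (rule inj_onI, rule ccontr)
    fix v w assume "v \<in> V" "w \<in> V" "s v = s w" "v \<noteq> w"
    then show False using ss[of v w] norm_s[of v] by (simp add: norm_eq_1)
  qed
  have "e \<notin> s ` V"
  proof
    assume "e \<in> s ` V"
    then obtain v where "v \<in> V" "e = s v" by auto
    then show False using se[of v] norm_e by (simp add: norm_eq_1)
  qed
  then have "card (insert e (s ` V)) = card V + 1"
    using fin inj by (simp add: card_image)
  moreover have "wide_directions (insert e (s ` V))"
    unfolding wide_directions_def pairwise_insert
  proof (intro conjI)
    show "insert e (s ` V) \<subseteq> sphere 0 1" using norm_s norm_e by auto
    show "pairwise (\<lambda>v w. v \<bullet> w < 1/2) (s ` V)" using ss by (force simp: pairwise_def)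
    show "\<forall>w. w \<in> s ` V \<and> w \<noteq> e \<longrightarrow> e \<bullet> w < 1/2 \<and> w \<bullet> e < 1/2"
      using se by (force simp: inner_commute)
  qed
  ultimately show ?thesis using that by blast
qed

section \<open>Iterated shrinking and coarse Lipschitz bounds\<close>

text \<open>Iterating the contraction of radii brings any separated set into a ball slightly larger
  than its limit radius, with no point lost. That ball has bounded capacity.\<close>

lemma separated_shrink_False:
  fixes r c :: real
  assumes "0 \<le> r" "r < 1" "0 \<le> c"
    and shrink: "\<And>R (S::'a::euclidean_space set). 0 \<le> R \<Longrightarrow> finite S \<Longrightarrow> S \<subseteq> cball 0 R \<Longrightarrow> separated S \<Longrightarrow>
       \<exists>T. finite T \<and> T \<subseteq> cball (0::'a) (r * R + c) \<and> separated T \<and> card T = card S"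
  shows False
proof -
  \<comment> \<open>\<open>b\<close> is the fixed point of \<open>R \<mapsto> r * R + c\<close>.\<close>
  define b where "b = c / (1 - r)"
  have b: "0 \<le> b" "r * b + c = b" using assms by (auto simp: b_def field_simps)
  obtain k where k: "\<And>(a::'a) S. S \<subseteq> cball a (b + 1) \<Longrightarrow> separated S \<Longrightarrow> finite S \<and> card S \<le> k"
    using separated_card_bounded by blast
  obtain e :: 'a where e: "norm e = 1" using vector_choose_size[of 1] by auto
  \<comment> \<open>\<open>{..k}\<close> has \<open>k + 1\<close> indices, one more than the
    capacity of the limit ball.\<close>
  define S where "S = (\<lambda>i. real i *\<^sub>R e) ` {..k}"
  have "separated S" "card S = card {..k}"
    unfolding S_def by (rule separated_image; use e in simp)+
  then have S: "finite S" "card S = k + 1" "S \<subseteq> cball 0 (real k)" "separated S"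
    using e by (auto simp: S_def)
  have iter: "\<exists>T. finite T \<and> T \<subseteq> cball (0::'a) (r ^ n * real k + b) \<and> separated T \<and> card T = k + 1" for n
  proof (induction n)
    case 0
    have "cball 0 (real k) \<subseteq> cball (0::'a) (real k + b)" using b(1) by auto
    then show ?case using S by (intro exI[of _ S]) auto
  next
    case (Suc n)
    then obtain T where T: "finite T" "T \<subseteq> cball (0::'a) (r ^ n * real k + b)" "separated T" "card T = k + 1"
      by auto
    have "r * (r ^ n * real k + b) + c = r ^ Suc n * real k + b" using b(2) by (simp add: algebra_simps)
    then show ?case using shrink[OF _ T(1-3)] T(4) b(1) assms(1) by (metis add_nonneg_nonneg
          mult_nonneg_nonneg of_nat_0_le_iff zero_le_power)
  qed
  have "(\<lambda>n. r ^ n * real k) \<longlonglongrightarrow> 0 * real k"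
    using assms by (intro tendsto_intros LIMSEQ_power_zero) auto
  then have "\<forall>\<^sub>F n in sequentially. r ^ n * real k < 1" by (intro order_tendstoD(2)) auto
  then obtain n where "r ^ n * real k < 1" by (meson eventually_sequentially order_refl)
  then have "cball (0::'a) (r ^ n * real k + b) \<subseteq> cball 0 (b + 1)" by auto
  moreover obtain T where "T \<subseteq> cball (0::'a) (r ^ n * real k + b)" "separated T" "card T = k + 1"
    using iter by blast
  ultimately have "card T \<le> k" using k[of T 0] by (meson subset_trans)
  then show False using \<open>card T = k + 1\<close> by simp
qed

lemma eventually_coarse_lipschitz:
  fixes F :: "('a::real_normed_vector \<Rightarrow> 'b::metric_space) filter"
  assumes "0 < a" "0 \<le> b"
    and step: "\<And>p q. dist p q < a \<Longrightarrow> \<forall>\<^sub>F f in F. dist (f p) (f q) \<le> b"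
  shows "\<forall>\<^sub>F f in F. dist (f p) (f q) \<le> b * (dist p q / a + 1)"
proof -
  \<comment> \<open>Number of equal steps from \<open>p\<close> to \<open>q\<close>. Adding
    \<open>1\<close> to the floor makes each step strictly shorter than \<open>a\<close>, and keeps
    \<open>n\<close> positive if \<open>p = q\<close>.\<close>
  define n where "n = nat \<lfloor>dist p q / a\<rfloor> + 1"
  have "0 \<le> dist p q / a" using \<open>0 < a\<close> by simp
  then have n: "dist p q / a < real n" "real n \<le> dist p q / a + 1" "real n > 0"
    unfolding n_def by linarith+
  define w where "w i = p + (real i / real n) *\<^sub>R (q - p)" for i
  have "dist (w i) (w (Suc i)) < a" for i
  proof -
    have "w (Suc i) - w i = (1 / real n) *\<^sub>R (q - p)"
      using n(3) by (simp add: w_def add_divide_distrib flip: scaleR_left_diff_distrib)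
    then have "dist (w i) (w (Suc i)) = dist p q / real n"
      by (simp add: dist_norm norm_minus_commute[of "w i"] norm_minus_commute[of p])
    moreover have "dist p q / real n < a"
      using n(1,3) \<open>0 < a\<close> by (simp add: pos_divide_less_eq mult.commute)
    ultimately show ?thesis by simp
  qed
  then have "\<forall>\<^sub>F f in F. \<forall>i\<in>{..<n}. dist (f (w i)) (f (w (Suc i))) \<le> b"
    by (intro eventually_ball_finite) (auto intro: step)
  then show ?thesis
  proof eventually_elim
    case (elim f)
    have "dist (f (w 0)) (f (w i)) \<le> b * real i" if "i \<le> n" for i
      using that
    proof (induction i)
      case (Suc i)
      have "dist (f (w 0)) (f (w (Suc i))) \<le> dist (f (w 0)) (f (w i)) + dist (f (w i)) (f (w (Suc i)))"
        by (rule dist_triangle)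
      also have "\<dots> \<le> b * real i + b" using Suc elim by (intro add_mono) auto
      finally show ?case by (simp add: algebra_simps)
    qed simp
    from this[of n] have "dist (f p) (f q) \<le> b * real n" using n(3) by (simp add: w_def)
    also have "\<dots> \<le> b * (dist p q / a + 1)" using n(2) \<open>0 \<le> b\<close> by (rule mult_left_mono)
    finally show ?case .
  qed
qed

text \<open>An eventual property of the filter \<open>F\<close> stands for a property of all adjacency-preserving
  maps on a sufficiently large finite set; this replaces bookkeeping of auxiliary points.\<close>

definition preserves_annulus :: "('a::euclidean_space \<Rightarrow> 'a) filter \<Rightarrow> real \<Rightarrow> real \<Rightarrow> bool" where
  "preserves_annulus F x y \<longleftrightarrow>
     (\<forall>p q. \<forall>\<^sub>F f in F. dist p q \<in> {1..x} \<longleftrightarrow> dist (f p) (f q) \<in> {1..y})"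

lemma eventually_adjacent:
  assumes "preserves_annulus F x y" "1 \<le> dist p q" "dist p q \<le> x"
  shows "\<forall>\<^sub>F f in F. 1 \<le> dist (f p) (f q) \<and> dist (f p) (f q) \<le> y"
proof -
  have "\<forall>\<^sub>F f in F. dist p q \<in> {1..x} \<longleftrightarrow> dist (f p) (f q) \<in> {1..y}"
    using assms(1) by (simp add: preserves_annulus_def)
  then show ?thesis by eventually_elim (use assms(2,3) in auto)
qed

lemma eventually_one_le_dist:
  assumes "preserves_annulus F x y" "1 \<le> dist p q" "dist p q \<le> x"
  shows "\<forall>\<^sub>F f in F. 1 \<le> dist (f p) (f q)"
  using eventually_adjacent[OF assms] by (rule eventually_mono) simp

lemma eventually_nonadjacent:
  assumes "preserves_annulus F x y" "dist p q < 1 \<or> x < dist p q"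
  shows "\<forall>\<^sub>F f in F. dist (f p) (f q) < 1 \<or> y < dist (f p) (f q)"
proof -
  have "\<forall>\<^sub>F f in F. dist p q \<in> {1..x} \<longleftrightarrow> dist (f p) (f q) \<in> {1..y}"
    using assms(1) by (simp add: preserves_annulus_def)
  then show ?thesis by eventually_elim (use assms(2) in auto)
qed

text \<open>At the common radius \<open>m\<close> the points are at least
  \<open>m * (1 + \<delta>)\<close> apart; moving each outward along its ray by at most
  \<open>n\<close> costs at most \<open>n\<close>.\<close>

lemma dist_ray_points:
  fixes v w :: "'a::real_normed_vector"
  assumes "norm v = 1" "norm w = 1" "0 \<le> m" "m \<le> s" "s \<le> m + n" "m \<le> t" "t \<le> m + n"
    and gap: "1 + \<delta> \<le> norm (v - w)"
  shows "m * (1 + \<delta>) - 2 * n \<le> dist (p + s *\<^sub>R v) (p + t *\<^sub>R w)"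
proof -
  have "m *\<^sub>R (v - w) = (s *\<^sub>R v - t *\<^sub>R w) - (s - m) *\<^sub>R v + (t - m) *\<^sub>R w"
    by (simp add: algebra_simps)
  then have "norm (m *\<^sub>R (v - w)) \<le> norm (s *\<^sub>R v - t *\<^sub>R w) + norm ((s - m) *\<^sub>R v) + norm ((t - m) *\<^sub>R w)"
    by (metis add_right_mono norm_triangle_ineq norm_triangle_ineq4 order_trans)
  moreover have "norm ((s - m) *\<^sub>R v) \<le> n" "norm ((t - m) *\<^sub>R w) \<le> n" using assms by auto
  moreover have "m * (1 + \<delta>) \<le> norm (m *\<^sub>R (v - w))"
    using assms(3) gap by (simp add: mult_left_mono)
  ultimately show ?thesis by (simp add: dist_norm)
qed

section \<open>Separating short distances from long ones\<close>

text \<open>Otherwise the images of \<open>p\<close> and \<open>q\<close> are more than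
  \<open>y\<close> apart. Rays from \<open>p\<close> in a largest family of wide directions carry
  common neighbours of \<open>p\<close> and \<open>q\<close>, nonadjacent across rays. Their images
  in the lens would yield a larger family.\<close>

lemma eventually_near:
  obtains C :: real where
    "\<And>F x y (p::'a::euclidean_space) q. C \<le> x \<Longrightarrow> 3 \<le> y \<Longrightarrow> preserves_annulus F x y \<Longrightarrow>
       dist p q < 1 \<Longrightarrow> \<forall>\<^sub>F f in F. dist (f p) (f q) < 1"
proof -
  obtain N where N: "\<And>(y::real) (a::'a) Z. 3 \<le> y \<Longrightarrow> Z \<subseteq> cball a y \<Longrightarrow> separated Z \<Longrightarrow> N \<le> card Z \<Longrightarrow>
       \<exists>z\<in>Z. \<forall>u. (\<forall>w\<in>Z. dist u w < 1 \<or> y < dist u w) \<longrightarrow> y < dist u z"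
    using separated_far_point by blast
  obtain V :: "'a set" where V: "wide_directions V" "finite V"
    "\<And>W::'a set. wide_directions W \<Longrightarrow> card W \<le> card V"
    using wide_directions_maximal by blast
  obtain \<delta> where \<delta>: "\<delta> > 0" "\<And>v w. v \<in> V \<Longrightarrow> w \<in> V \<Longrightarrow> v \<noteq> w \<Longrightarrow> 1 + \<delta> \<le> norm (v - w)"
    using wide_directions_gap[OF V(1,2)] by blast
  have normV: "norm v = 1" if "v \<in> V" for v using V(1) that by (auto simp: wide_directions_def)
  \<comment> \<open>\<open>N + 2\<close> leaves room on each ray for \<open>N\<close> points at
    distance \<open>2\<close> to \<open>x - 1\<close> from \<open>p\<close>, hence adjacent to
    \<open>q\<close> as well. The fraction makes the bound of \<open>dist_ray_points\<close>, with
    \<open>m = x - N\<close> and \<open>n = N\<close>, exceed \<open>x\<close>.\<close>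
  define C where "C = real N + 2 + (real N * (1 + \<delta>) + 2 * real N) / \<delta>"
  have "\<forall>\<^sub>F f in F. dist (f p) (f q) < 1"
    if x: "C \<le> x" and y: "3 \<le> y" and F: "preserves_annulus F x y" and pq: "dist p q < 1"
    for F x y and p q :: 'a
  proof -
    have x1: "real N + 2 \<le> x" using x \<delta>(1) unfolding C_def
      by (smt (verit, best) divide_nonneg_pos mult_nonneg_nonneg of_nat_0_le_iff)
    have "(real N * (1 + \<delta>) + 2 * real N) / \<delta> < x" using x unfolding C_def by linarith
    then have x2: "x < (x - N) * (1 + \<delta>) - 2 * real N" using \<delta>(1) by (simp add: field_simps)
    \<comment> \<open>A single point on each ray would not do: images of points on different rays may be
      closer than 1. Among \<open>N\<close> points of a ray, one has an image that is far from those of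
      the other rays.\<close>
    define u where "u v k = p + (x - 1 - real k) *\<^sub>R v" for v :: 'a and k :: nat
    have du: "dist p (u v k) = x - 1 - real k" if "v \<in> V" "k < N" for v k
      using normV[OF that(1)] that(2) x1 by (simp add: u_def dist_norm)
    have duq: "\<bar>dist q (u v k) - (x - 1 - real k)\<bar> < 1" if "v \<in> V" "k < N" for v k
      using du[OF that] pq dist_triangle[of q "u v k" p] dist_triangle[of p "u v k" q]
      by (simp add: dist_commute)
    have e1: "\<forall>\<^sub>F f in F. \<forall>v\<in>V. \<forall>k\<in>{..<N}. 1 \<le> dist (f p) (f (u v k)) \<and> dist (f p) (f (u v k)) \<le> y"
      using V(2) x1 du
      by (intro eventually_ball_finite ballI eventually_adjacent[OF F]) auto
    have e2: "\<forall>\<^sub>F f in F. \<forall>v\<in>V. \<forall>k\<in>{..<N}. 1 \<le> dist (f q) (f (u v k)) \<and> dist (f q) (f (u v k)) \<le> y"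
    proof (intro eventually_ball_finite ballI eventually_adjacent[OF F] V(2) finite_lessThan)
      fix v k assume "v \<in> V" "k \<in> {..<N}"
      then show "1 \<le> dist q (u v k)" "dist q (u v k) \<le> x" using duq[of v k] x1 by auto
    qed
    have e3: "\<forall>\<^sub>F f in F. \<forall>v\<in>V. \<forall>k\<in>{..<N}. \<forall>l\<in>{..<N}. k \<noteq> l \<longrightarrow> 1 \<le> dist (f (u v k)) (f (u v l))"
    proof (intro eventually_ball_finite ballI V(2) finite_lessThan)
      fix v k l assume v: "v \<in> V" and kl: "k \<in> {..<N}" "l \<in> {..<N}"
      have "dist (u v k) (u v l) = \<bar>real l - real k\<bar>"
        using normV[OF v] by (simp add: u_def dist_norm flip: scaleR_left_diff_distrib)
      then have "k \<noteq> l \<Longrightarrow> 1 \<le> dist (u v k) (u v l) \<and> dist (u v k) (u v l) \<le> x"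
        using kl x1 by auto
      then show "\<forall>\<^sub>F f in F. k \<noteq> l \<longrightarrow> 1 \<le> dist (f (u v k)) (f (u v l))"
        by (cases "k = l") (auto intro!: eventually_one_le_dist[OF F])
    qed
    have e4: "\<forall>\<^sub>F f in F. \<forall>v\<in>V. \<forall>w\<in>V. \<forall>k\<in>{..<N}. \<forall>l\<in>{..<N}.
        v \<noteq> w \<longrightarrow> dist (f (u v k)) (f (u w l)) < 1 \<or> y < dist (f (u v k)) (f (u w l))"
    proof (intro eventually_ball_finite ballI V(2) finite_lessThan)
      fix v w k l assume v: "v \<in> V" "w \<in> V" and kl: "k \<in> {..<N}" "l \<in> {..<N}"
      have "x < dist (u v k) (u w l)" if "v \<noteq> w"
      proof -
        have "(x - N) * (1 + \<delta>) - 2 * real N \<le> dist (u v k) (u w l)"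
          unfolding u_def using x1 v kl normV \<delta>(2) that by (intro dist_ray_points) auto
        then show ?thesis using x2 by linarith
      qed
      then show "\<forall>\<^sub>F f in F. v \<noteq> w \<longrightarrow> dist (f (u v k)) (f (u w l)) < 1 \<or> y < dist (f (u v k)) (f (u w l))"
        by (cases "v = w") (auto intro!: eventually_nonadjacent[OF F])
    qed
    have e5: "\<forall>\<^sub>F f in F. dist (f p) (f q) < 1 \<or> y < dist (f p) (f q)"
      using eventually_nonadjacent[OF F] pq by blast
    from e1 e2 e3 e4 e5 show ?thesis
    proof eventually_elim
      case (elim f)
      show ?case
      proof (rule ccontr)
        assume "\<not> ?case"
        then have ypq: "y < dist (f p) (f q)" using elim(5) by auto
        define Z where "Z v = (\<lambda>k. f (u v k)) ` {..<N}" for v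
        have "\<exists>z\<in>Z v. \<forall>c. (\<forall>w\<in>Z v. dist c w < 1 \<or> y < dist c w) \<longrightarrow> y < dist c z" if v: "v \<in> V" for v
        proof (rule N[OF y])
          show "Z v \<subseteq> cball (f p) y" using elim(1) v by (auto simp: Z_def)
          have sep: "1 \<le> dist (f (u v k)) (f (u v l))" if "k \<in> {..<N}" "l \<in> {..<N}" "k \<noteq> l" for k l
            using elim(3) v that by blast
          show "separated (Z v)" unfolding Z_def by (rule separated_image(1)) (rule sep)
          have "card (Z v) = card {..<N}" unfolding Z_def by (rule separated_image(2)) (rule sep)
          then show "N \<le> card (Z v)" by simp
        qed
        then obtain z where z: "\<And>v. v \<in> V \<Longrightarrow> z v \<in> Z v"
            "\<And>v c. v \<in> V \<Longrightarrow> (\<forall>w\<in>Z v. dist c w < 1 \<or> y < dist c w) \<Longrightarrow> y < dist c (z v)"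
          by metis
        \<comment> \<open>\<open>z v\<close> is nonadjacent to all images on the ray of
          \<open>w\<close>, so the choice of \<open>z w\<close> excludes a distance below
          \<open>1\<close>.\<close>
        have far: "y < dist (z v) (z w)" if vw: "v \<in> V" "w \<in> V" "v \<noteq> w" for v w
        proof (rule z(2)[OF vw(2)])
          show "\<forall>c\<in>Z w. dist (z v) c < 1 \<or> y < dist (z v) c"
          proof
            fix c assume "c \<in> Z w"
            then obtain l where l: "l \<in> {..<N}" "c = f (u w l)" by (auto simp: Z_def)
            obtain k where k: "k \<in> {..<N}" "z v = f (u v k)"
              using z(1)[OF vw(1)] by (auto simp: Z_def)
            show "dist (z v) c < 1 \<or> y < dist (z v) c"
              using elim(4)[rule_format, OF vw(1,2) k(1) l(1) vw(3)] k l by simp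
          qed
        qed
        have lens: "z v \<noteq> f p" "dist (f p) (z v) \<le> y" "dist (f q) (z v) \<le> y" if v: "v \<in> V" for v
        proof -
          obtain k where k: "k \<in> {..<N}" "z v = f (u v k)" using z(1)[OF v] by (auto simp: Z_def)
          show "z v \<noteq> f p" "dist (f p) (z v) \<le> y" "dist (f q) (z v) \<le> y"
            using elim(1)[rule_format, OF v k(1)] elim(2)[rule_format, OF v k(1)] k(2) by auto
        qed
        have "0 \<le> y" using y by simp
        obtain W :: "'a set" where "wide_directions W" "card W = card V + 1"
          by (rule wide_directions_lens[OF ypq V(2) lens far \<open>0 \<le> y\<close>])
        then show False using V(3)[of W] by simp
      qed
    qed
  qed
  then show ?thesis using that by blast
qed

text \<open>Images of nonadjacent points are either very close or far apart. Being very close is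
  excluded by packing, with a coarse Lipschitz bound ruling out that nearby images jump beyond
  \<open>y\<close>.\<close>

lemma eventually_far:
  obtains C :: real where
    "\<And>F x y (p::'a::euclidean_space) q. C \<le> x \<Longrightarrow> C \<le> y \<Longrightarrow> preserves_annulus F x y \<Longrightarrow>
       (\<And>p q. dist p q < 1 \<Longrightarrow> \<forall>\<^sub>F f in F. dist (f p) (f q) \<le> 1) \<Longrightarrow>
       x < dist p q \<Longrightarrow> \<forall>\<^sub>F f in F. y < dist (f p) (f q)"
proof -
  obtain k where k: "\<And>(a::'a) S. S \<subseteq> cball a 1 \<Longrightarrow> separated S \<Longrightarrow> finite S \<and> card S \<le> k"
    using separated_card_bounded by blast
  have "\<forall>\<^sub>F f in F. y < dist (f p) (f q)"
    \<comment> \<open>For \<open>i \<le> k\<close> the image of \<open>u i\<close> is within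
      \<open>i + 2\<close> of that of \<open>p\<close>, and within \<open>i + 3\<close> of that of
      \<open>q\<close> if these two are close. The bound on \<open>x\<close> keeps the points
      \<open>u i\<close> mutually adjacent.\<close>
    if x: "real k + 3 \<le> x" and y: "real k + 3 \<le> y" and F: "preserves_annulus F x y"
      and near: "\<And>p q. dist p q < 1 \<Longrightarrow> \<forall>\<^sub>F f in F. dist (f p) (f q) \<le> 1"
      and pq: "x < dist p q"
    for F x y and p q :: 'a
  proof -
    define e where "e = sgn (p - q)"
    have "p \<noteq> q" using pq x by auto
    then have e: "norm e = 1" "p - q = dist p q *\<^sub>R e"
      by (auto simp: e_def norm_sgn sgn_div_norm dist_norm)
    \<comment> \<open>If the images of \<open>p\<close> and \<open>q\<close> were close, those of the points
      \<open>u i\<close>, nonadjacent to \<open>q\<close>, would crowd around that of \<open>q\<close>.\<close>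
    define u where "u i = p + real (Suc i) *\<^sub>R e" for i
    have dq: "dist (u i) q = dist p q + real (Suc i)" for i
    proof -
      have "u i - q = (dist p q + real (Suc i)) *\<^sub>R e"
        using e(2) unfolding u_def by (simp only: scaleR_add_left) (simp add: algebra_simps)
      then have "norm (u i - q) = dist p q + real (Suc i)"
        using e(1) by (simp only: norm_scaleR) simp
      then show ?thesis by (simp add: dist_norm)
    qed
    have dp: "dist (u i) p = real (Suc i)" for i using e(1) by (simp add: u_def dist_norm del: of_nat_Suc)
    have du: "dist (u i) (u j) = \<bar>real i - real j\<bar>" for i j
      using e(1) by (simp add: u_def dist_norm flip: scaleR_left_diff_distrib)
    have e1: "\<forall>\<^sub>F f in F. \<forall>i\<in>{..k}. dist (f (u i)) (f p) \<le> real (Suc i) + 1"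
      using eventually_coarse_lipschitz[of 1 1 F "u _" p] near dp
      by (intro eventually_ball_finite ballI) auto
    have e2: "\<forall>\<^sub>F f in F. \<forall>i\<in>{..k}. dist (f (u i)) (f q) < 1 \<or> y < dist (f (u i)) (f q)"
      using dq pq by (intro eventually_ball_finite ballI eventually_nonadjacent[OF F]) auto
    have e3: "\<forall>\<^sub>F f in F. \<forall>i\<in>{..k}. \<forall>j\<in>{..k}. i \<noteq> j \<longrightarrow> 1 \<le> dist (f (u i)) (f (u j))"
    proof (intro eventually_ball_finite ballI finite_atMost)
      fix i j assume "i \<in> {..k}" "j \<in> {..k}"
      then have "i \<noteq> j \<Longrightarrow> 1 \<le> dist (u i) (u j) \<and> dist (u i) (u j) \<le> x"
        using du x by auto
      then show "\<forall>\<^sub>F f in F. i \<noteq> j \<longrightarrow> 1 \<le> dist (f (u i)) (f (u j))"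
        by (cases "i = j") (auto intro!: eventually_one_le_dist[OF F])
    qed
    have e4: "\<forall>\<^sub>F f in F. dist (f p) (f q) < 1 \<or> y < dist (f p) (f q)"
      using eventually_nonadjacent[OF F] pq by blast
    from e1 e2 e3 e4 show ?thesis
    proof eventually_elim
      case (elim f)
      show ?case
      proof (rule ccontr)
        assume "\<not> ?case"
        then have pq1: "dist (f p) (f q) < 1" using elim(4) by auto
        have "dist (f (u i)) (f q) < 1" if "i \<le> k" for i
        proof -
          have "dist (f (u i)) (f p) \<le> real (Suc i) + 1" using elim(1) that by blast
          then have "dist (f (u i)) (f q) < real i + 3"
            using pq1 dist_triangle[of "f (u i)" "f q" "f p"] by simp
          also have "\<dots> \<le> y" using y that by linarith
          finally show ?thesis using elim(2) that by force
        qed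
        then have "(\<lambda>i. f (u i)) ` {..k} \<subseteq> cball (f q) 1"
          by (force simp: dist_commute)
        moreover have sep: "1 \<le> dist (f (u i)) (f (u j))" if "i \<in> {..k}" "j \<in> {..k}" "i \<noteq> j" for i j
          using elim(3) that by blast
        have "separated ((\<lambda>i. f (u i)) ` {..k})" by (rule separated_image(1)) (rule sep)
        ultimately have "card ((\<lambda>i. f (u i)) ` {..k}) \<le> k" using k by blast
        moreover have "card ((\<lambda>i. f (u i)) ` {..k}) = card {..k}"
          by (rule separated_image(2)) (rule sep)
        ultimately show False by simp
      qed
    qed
  qed
  then show ?thesis using that by blast
qed

section \<open>Rescaling, limit filter and comparison of radii\<close>

text \<open>Measuring the source in units of \<open>s\<close> and the target in units of
  \<open>t\<close> turns the two bounds into the shrinking hypothesis. Since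
  \<open>F \<noteq> bot\<close>, some single map satisfies all the bounds needed for a finite
  \<open>S\<close>.\<close>

lemma eventually_separated_shrink_False:
  fixes F :: "('a::euclidean_space \<Rightarrow> 'a) filter"
  assumes "F \<noteq> bot" "0 < s" "0 < t" "0 \<le> r" "r < 1" "0 \<le> c"
    and expand: "\<And>p q. s \<le> dist p q \<Longrightarrow> \<forall>\<^sub>F f in F. t \<le> dist (f p) (f q)"
    and bound: "\<And>p. \<forall>\<^sub>F f in F. dist (f 0) (f p) \<le> t * (r * (norm p / s) + c)"
  shows False
proof (rule separated_shrink_False[where 'a='a, OF \<open>0 \<le> r\<close> \<open>r < 1\<close> \<open>0 \<le> c\<close>])
  fix R :: real and S :: "'a set"
  assume R: "0 \<le> R" and S: "finite S" "S \<subseteq> cball 0 R" "separated S"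
  have e1: "\<forall>\<^sub>F f in F. \<forall>p\<in>S. dist (f 0) (f (s *\<^sub>R p)) \<le> t * (r * R + c)"
  proof (intro eventually_ball_finite ballI S(1))
    fix p assume p: "p \<in> S"
    have "\<forall>\<^sub>F f in F. dist (f 0) (f (s *\<^sub>R p)) \<le> t * (r * norm p + c)"
      using bound[of "s *\<^sub>R p"] \<open>0 < s\<close> by simp
    moreover have "t * (r * norm p + c) \<le> t * (r * R + c)"
      using S(2) p assms(3,4) by (intro mult_left_mono add_right_mono) auto
    ultimately show "\<forall>\<^sub>F f in F. dist (f 0) (f (s *\<^sub>R p)) \<le> t * (r * R + c)"
      by (auto elim: eventually_mono)
  qed
  have e2: "\<forall>\<^sub>F f in F. \<forall>p\<in>S. \<forall>q\<in>S. p \<noteq> q \<longrightarrow> t \<le> dist (f (s *\<^sub>R p)) (f (s *\<^sub>R q))"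
  proof (intro eventually_ball_finite ballI S(1))
    fix p q assume pq: "p \<in> S" "q \<in> S"
    have "s \<le> dist (s *\<^sub>R p) (s *\<^sub>R q)" if "p \<noteq> q"
      using pq that S(3) \<open>0 < s\<close> by (auto simp: dist_norm pairwise_def simp flip: scaleR_diff_right)
    then show "\<forall>\<^sub>F f in F. p \<noteq> q \<longrightarrow> t \<le> dist (f (s *\<^sub>R p)) (f (s *\<^sub>R q))"
      using expand by (cases "p = q") auto
  qed
  define good where "good f \<longleftrightarrow> (\<forall>p\<in>S. dist (f 0) (f (s *\<^sub>R p)) \<le> t * (r * R + c) \<and>
      (\<forall>q\<in>S. p \<noteq> q \<longrightarrow> t \<le> dist (f (s *\<^sub>R p)) (f (s *\<^sub>R q))))" for f :: "'a \<Rightarrow> 'a"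
  from e1 e2 have "eventually good F" by eventually_elim (simp add: good_def)
  then obtain f where "good f" using eventually_happens'[OF \<open>F \<noteq> bot\<close>] by blast
  then have f: "dist (f 0) (f (s *\<^sub>R p)) \<le> t * (r * R + c)"
      "q \<in> S \<Longrightarrow> p \<noteq> q \<Longrightarrow> t \<le> dist (f (s *\<^sub>R p)) (f (s *\<^sub>R q))" if "p \<in> S" for p q
    using that by (simp_all add: good_def)
  define g where "g p = (f (s *\<^sub>R p) - f 0) /\<^sub>R t" for p
  have g: "1 \<le> dist (g p) (g q)" if "p \<in> S" "q \<in> S" "p \<noteq> q" for p q
  proof -
    have "g p - g q = (f (s *\<^sub>R p) - f (s *\<^sub>R q)) /\<^sub>R t" by (simp add: g_def algebra_simps)
    then have "dist (g p) (g q) = dist (f (s *\<^sub>R p)) (f (s *\<^sub>R q)) / t"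
      using \<open>0 < t\<close> by (simp add: dist_norm divide_inverse mult.commute)
    then show ?thesis using f(2)[OF that] \<open>0 < t\<close> by simp
  qed
  have "norm (g p) \<le> r * R + c" if "p \<in> S" for p
  proof -
    have "norm (g p) = dist (f 0) (f (s *\<^sub>R p)) / t"
      unfolding g_def using \<open>0 < t\<close>
      by (simp only: norm_scaleR dist_norm norm_minus_commute[of "f 0"]) (simp add: divide_inverse mult.commute)
    then show ?thesis using f(1)[OF that] \<open>0 < t\<close> by (simp add: pos_divide_le_eq mult.commute)
  qed
  then have "g ` S \<subseteq> cball 0 (r * R + c)" by auto
  moreover have "separated (g ` S)" "card (g ` S) = card S"
    using separated_image[of S g] g by auto
  ultimately show "\<exists>T. finite T \<and> T \<subseteq> cball (0::'a) (r * R + c) \<and> separated T \<and> card T = card S"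
    using S(1) by blast
qed

text \<open>Each finite \<open>W\<close> defines a graph, and its embedding for \<open>y\<close>
  gives a map in \<open>good W\<close>. These nonempty sets are directed, since
  \<open>good (A \<union> B)\<close> lies in both \<open>good A\<close> and \<open>good B\<close>,
  so they generate a proper filter.\<close>

lemma annulus_graphs_subset_filter:
  assumes sub: "annulus_graphs TYPE('d::finite) 1 x \<subseteq> annulus_graphs TYPE('d) 1 y"
  obtains F :: "(real ^ 'd \<Rightarrow> real ^ 'd) filter" where "F \<noteq> bot" "preserves_annulus F x y"
proof -
  define good where "good W = {g :: real ^ 'd \<Rightarrow> real ^ 'd. \<forall>p\<in>W. \<forall>q\<in>W.
      dist p q \<in> {1..x} \<longleftrightarrow> dist (g p) (g q) \<in> {1..y}}" for W
  have nonempty: "good W \<noteq> {}" if W: "finite W" for W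
  proof -
    obtain h where h: "bij_betw h {0..<card W} W" using W ex_bij_betw_nat_finite by blast
    define V where "V = {0..<card W}"
    define G where "G = (V, {{i, j} |i j. i \<in> V \<and> j \<in> V \<and> i \<noteq> j \<and> dist (h i) (h j) \<in> {1..x}})"
    have edge: "{i, j} \<in> edges G \<longleftrightarrow> dist (h i) (h j) \<in> {1..x}" if "i \<in> V" "j \<in> V" "i \<noteq> j" for i j
      using that unfolding G_def by (auto simp: doubleton_eq_iff dist_commute)
    have "finite_simple_graph G"
      by (auto simp: finite_simple_graph_def G_def V_def)
    moreover have "annulus_embedding 1 x G h"
      using h edge by (auto simp: annulus_embedding_def G_def V_def bij_betw_def)
    ultimately have "G \<in> annulus_graphs TYPE('d) 1 y"
      using sub by (auto simp: annulus_graphs_def)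
    then obtain f :: "nat \<Rightarrow> real ^ 'd" where f: "annulus_embedding 1 y G f"
      by (auto simp: annulus_graphs_def)
    \<comment> \<open>Only the values on \<open>W\<close> matter; elsewhere the inverse is
      unspecified.\<close>
    define g where "g = f \<circ> the_inv_into V h"
    have inj: "inj_on h V" and im: "h ` V = W" using h by (auto simp: bij_betw_def V_def)
    have "dist (h i) (h j) \<in> {1..x} \<longleftrightarrow> dist (g (h i)) (g (h j)) \<in> {1..y}" if "i \<in> V" "j \<in> V" for i j
    \<comment> \<open>For equal indices both distances are \<open>0\<close>, outside both
      annuli.\<close>
    proof (cases "i = j")
      case False
      then have "dist (h i) (h j) \<in> {1..x} \<longleftrightarrow> dist (f i) (f j) \<in> {1..y}"
        using f edge[OF that] that by (simp add: annulus_embedding_def G_def)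
      then show ?thesis using that inj by (simp add: g_def the_inv_into_f_f)
    qed simp
    then have "g \<in> good W" unfolding good_def using im by blast
    then show ?thesis by blast
  qed
  define F where "F = (INF W\<in>{W. finite W}. principal (good W))"
  have ev: "eventually P F \<longleftrightarrow> (\<exists>W\<in>{W. finite W}. eventually P (principal (good W)))" for P
    unfolding F_def
  proof (rule eventually_INF_base)
    fix A B :: "(real ^ 'd) set" assume "A \<in> {W. finite W}" "B \<in> {W. finite W}"
    then show "\<exists>W\<in>{W. finite W}. principal (good W) \<le> inf (principal (good A)) (principal (good B))"
      by (intro bexI[of _ "A \<union> B"]) (auto simp: good_def)
  qed auto
  have "F \<noteq> bot" using nonempty by (auto simp: trivial_limit_def ev eventually_principal)
  moreover have "preserves_annulus F x y"
    unfolding preserves_annulus_def ev eventually_principal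
  proof (intro allI)
    fix p q :: "real ^ 'd"
    show "\<exists>W\<in>{W. finite W}. \<forall>f\<in>good W. dist p q \<in> {1..x} \<longleftrightarrow> dist (f p) (f q) \<in> {1..y}"
      by (intro bexI[of _ "{p, q}"]) (auto simp: good_def)
  qed
  ultimately show ?thesis using that by blast
qed

lemma preserves_annulus_rigid:
  obtains C :: real where
    "\<And>(F :: ('a::euclidean_space \<Rightarrow> 'a) filter) x y. C \<le> x \<Longrightarrow> C \<le> y \<Longrightarrow> F \<noteq> bot \<Longrightarrow> preserves_annulus F x y \<Longrightarrow> x = y"
proof -
  obtain C1 where C1: "\<And>F x y (p::'a) q. C1 \<le> x \<Longrightarrow> 3 \<le> y \<Longrightarrow> preserves_annulus F x y \<Longrightarrow>
       dist p q < 1 \<Longrightarrow> \<forall>\<^sub>F f in F. dist (f p) (f q) < 1"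
    using eventually_near by blast
  obtain C2 where C2: "\<And>F x y (p::'a) q. C2 \<le> x \<Longrightarrow> C2 \<le> y \<Longrightarrow> preserves_annulus F x y \<Longrightarrow>
       (\<And>p q. dist p q < 1 \<Longrightarrow> \<forall>\<^sub>F f in F. dist (f p) (f q) \<le> 1) \<Longrightarrow>
       x < dist p q \<Longrightarrow> \<forall>\<^sub>F f in F. y < dist (f p) (f q)"
    using eventually_far by blast
  have "x = y" if C: "Max {3, C1, C2} \<le> x" "Max {3, C1, C2} \<le> y"
    and F: "F \<noteq> bot" "preserves_annulus F x y" for F :: "('a \<Rightarrow> 'a) filter" and x y
  proof -
    have x: "3 \<le> x" "C1 \<le> x" "C2 \<le> x" and y: "3 \<le> y" "C2 \<le> y" using C by auto
    have near: "\<forall>\<^sub>F f in F. dist (f p) (f q) \<le> 1" if "dist p q < 1" for p q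
      using C1[OF x(2) y(1) F(2) that] by (auto elim: eventually_mono)
    note far = C2[OF x(3) y(2) F(2) near]
    have "\<not> y < x"
    proof
      assume "y < x"
      have step: "\<forall>\<^sub>F f in F. dist (f p) (f q) \<le> y" if "dist p q < x" for p q
        using that near[of p q] eventually_adjacent[OF F(2), of p q] y(1)
        by (cases "dist p q < 1") (auto elim!: eventually_mono)
      show False
      \<comment> \<open>Steps shorter than \<open>x\<close> have images at most \<open>y\<close>
        apart, so chaining gives slope \<open>y / x\<close> and additive error \<open>y\<close>.
        Separation \<open>1\<close> survives at every scale, as pairs beyond \<open>x\<close> go
        beyond \<open>y\<close>.\<close>
      proof (rule eventually_separated_shrink_False[OF F(1), of 1 1 "y / x" y])
        show "\<forall>\<^sub>F f in F. 1 \<le> dist (f p) (f q)" if "1 \<le> dist p q" for p q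
          using that far[of p q] eventually_adjacent[OF F(2), of p q] y(1)
          by (cases "dist p q \<le> x") (auto elim!: eventually_mono)
        show "\<forall>\<^sub>F f in F. dist (f 0) (f p) \<le> 1 * (y / x * (norm p / 1) + y)" for p
          using eventually_coarse_lipschitz[of x y F 0 p] step x y by (simp add: algebra_simps)
      qed (use \<open>y < x\<close> y in auto)
    qed
    moreover have "\<not> x < y"
    proof
      assume "x < y"
      \<comment> \<open>Any value strictly between works: \<open>s > x\<close> sends
        \<open>s\<close>-separated pairs beyond \<open>y\<close>, and \<open>s < y\<close> makes the
        ratio \<open>s / y\<close> less than \<open>1\<close>.\<close>
      define s where "s = (x + y) / 2"
      have s: "x < s" "s < y" "0 < s" using \<open>x < y\<close> x by (auto simp: s_def)
      show False
      \<comment> \<open>The unscaled bound is \<open>norm p + 1\<close>; its additive error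
        \<open>1\<close> becomes \<open>1 / y\<close> in units of \<open>y\<close>.\<close>
      proof (rule eventually_separated_shrink_False[OF F(1), of s y "s / y" "1 / y"])
        show "\<forall>\<^sub>F f in F. y \<le> dist (f p) (f q)" if "s \<le> dist p q" for p q
          using that far[of p q] s by (auto elim!: eventually_mono)
        show "\<forall>\<^sub>F f in F. dist (f 0) (f p) \<le> y * (s / y * (norm p / s) + 1 / y)" for p
        proof -
          have "y * (s / y * (norm p / s) + 1 / y) = norm p + 1"
            using s y by (simp add: field_simps)
          then show ?thesis using eventually_coarse_lipschitz[of 1 1 F 0 p] near by simp
        qed
      qed (use s y in auto)
    qed
    ultimately show ?thesis by simp
  qed
  then show ?thesis using that by blast
qed

theorem theorem1p1:
  shows "\<exists>C::real. C > 0 \<and>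
    (\<forall>x y :: real. x \<ge> C \<longrightarrow> y \<ge> C \<longrightarrow> x \<noteq> y \<longrightarrow>
       \<not> annulus_graphs TYPE('d::finite) 1 x \<subseteq> annulus_graphs TYPE('d) 1 y)"
proof -
  obtain C where C: "\<And>(F :: (real ^ 'd \<Rightarrow> real ^ 'd) filter) x y. C \<le> x \<Longrightarrow> C \<le> y \<Longrightarrow> F \<noteq> bot \<Longrightarrow>
      preserves_annulus F x y \<Longrightarrow> x = y"
    using preserves_annulus_rigid by blast
  show ?thesis
  \<comment> \<open>The maximum with \<open>1\<close> makes the constant positive.\<close>
  proof (intro exI[of _ "max 1 C"] conjI allI impI notI)
    fix x y :: real
    assume xy: "max 1 C \<le> x" "max 1 C \<le> y" "x \<noteq> y"
      and sub: "annulus_graphs TYPE('d) 1 x \<subseteq> annulus_graphs TYPE('d) 1 y"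
    obtain F :: "(real ^ 'd \<Rightarrow> real ^ 'd) filter" where "F \<noteq> bot" "preserves_annulus F x y"
      using annulus_graphs_subset_filter[OF sub] by blast
    then show False using C[of x y F] xy by simp
  qed simp
qed

end
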